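(* Let $\mathscr{C}$ be an $\mathbf{Ord}$-enriched category. Every lax algebraic weak factorisation system $(F,L,R,K)$ on $\mathscr{C}$ is a lax functorial weak factorisation system; that is, there is a lax weak factorisation system $(\mathcal{L},\mathcal{R})$ on $\mathscr{C}$ such that $Lf\in\mathcal{L}$ and $Rf\in\mathcal{R}$ for every morphism $f$ of $\mathscr{C}$.
   Context: An $\mathbf{Ord}$-enriched category is a category whose hom-sets are partially ordered and whose composition is monotone in each variable. Lax squares: for $f:A\to B$ and $g:C\to D$, a lax square $(u,v):f\to g$ is a pair $u:A\to C$, $v:B\to D$ with $g\cdot u\le v\cdot f$. $\mathscr{C}^2_{\mathrm{lax}}$ is the category whose objects are the morphisms of $\mathscr{C}$ and whose morphisms are lax squares; lax squares $f\to g$ are ordered componentwise. $f\perp_{\mathrm{lax}} g$ means: for every lax square $(u,v):f\to g$ there is $d:\mathrm{cod}(f)\to\mathrm{dom}(g)$ with $u\le d\cdot f$ and $g\cdot d\le v$. A lax weak factorisation system is a pair $(\mathcal{L},\mathcal{R})$ of classes of morphisms such that $\mathcal{R}=\{g\mid f\perp_{\mathrm{lax}}g\ \forall f\in\mathcal{L}\}$, $\mathcal{L}=\{f\mid f\perp_{\mathrm{lax}}g\ \forall g\in\mathcal{R}\}$ and every morphism factors as $r\cdot l$ with $l\in\mathcal{L}$, $r\in\mathcal{R}$. A lax functorial factorisation system $(F,L,R,K)$ is a functor $F:\mathscr{C}^2_{\mathrm{lax}}\to\mathscr{C}^2_{\mathrm{lax}}\times_{\mathscr{C}}\mathscr{C}^2_{\mathrm{lax}}$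 that is a section of the composition functor. Explicitly: to each $f:A\to B$ it assigns $Lf:A\to Kf$, $Rf:Kf\to B$ with $Rf\cdot Lf=f$, and to each lax square $(u,v):f\to g$ a morphism $K(u,v):Kf\to Kg$ with $Lg\cdot u\le K(u,v)\cdot Lf$ and $Rg\cdot K(u,v)\le v\cdot Rf$, functorially in lax squares. Then $L$ and $R$ are endofunctors of $\mathscr{C}^2_{\mathrm{lax}}$ with $L(u,v)=(u,K(u,v))$ and $R(u,v)=(K(u,v),v)$. There are families $\eta:\mathrm{Id}\Rightarrow R$, $\eta_f=(Lf,\mathrm{id}_B):f\to Rf$, and $\varepsilon:L\Rightarrow\mathrm{Id}$, $\varepsilon_f=(\mathrm{id}_A,Rf):Lf\to f$; both are oplax natural. A family $\alpha_X:SX\to TX$ between functors $S,T$ into an $\mathbf{Ord}$-enriched category is an oplax natural transformation if $\alpha_Y\cdot S h\le T h\cdot\alpha_X$ for every $h:X\to Y$. A lax monad $(T,\eta,\mu)$ consists of an endofunctor $T$ and oplax natural transformations $\eta:\mathrm{Id}\Rightarrow T$, $\mu:TT\Rightarrow T$ with $\mathrm{id}_T\le\mu\cdot T\eta$, $\mu\cdot\eta_T\le\mathrm{id}_T$ and $\mu\cdot T\mu\le\mu\cdot\mu_T$. Dually, a lax comonad $(T,\varepsilon,\delta)$ consists of an endofunctor $T$ and oplax natural transformations $\varepsilon:T\Rightarrow\mathrm{Id}$, $\delta:T\Rightarrow TT$ with $T\varepsilon\cdot\delta\le\mathrm{id}_T$, $\mathrm{id}_T\le\varepsilon_T\cdot\delta$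 and $\delta_T\cdot\delta\le T\delta\cdot\delta$. A lax algebraic weak factorisation system is a lax functorial factorisation system $(F,L,R,K)$ such that $(R,\eta)$ is part of a lax monad $(R,\eta,\Theta)$ on $\mathscr{C}^2_{\mathrm{lax}}$, $(L,\varepsilon)$ is part of a lax comonad $(L,\varepsilon,\Omega)$ on $\mathscr{C}^2_{\mathrm{lax}}$, and there exists a distributivity law $\Delta:LR\Rightarrow RL$ of the comonad over the monad, i.e. a transformation with components $\Delta_f:LRf\to RLf$ in $\mathscr{C}^2_{\mathrm{lax}}$ satisfying $\Delta\cdot L\Theta=\Theta_L\cdot R\Delta\cdot\Delta_R$ and $R\Omega\cdot\Delta=\Delta_L\cdot L\Delta\cdot\Omega_R$.
   Formalization: The distributivity law Δ is required to have the canonical components Δ_f = (ω_f, θ_f), where Ω_f = (id, ω_f) and Θ_f = (θ_f, id); for an arbitrary transformation Δ satisfying only the two listed equations the claim is false. *)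

theory Defs
  imports Main
begin

section \<open>Ord-enriched categories\<close>

text \<open>\<open>Comp C g f\<close> is the composite of \<open>f\<close> followed by \<open>g\<close>; it is only meaningful when
  \<open>Cod C f = Dom C g\<close>. Likewise \<open>Le\<close> is only meaningful on parallel morphisms.\<close>

record ('o, 'm) ord_cat =
  Ob :: "'o set"
  Mor :: "'m set"
  Dom :: "'m \<Rightarrow> 'o"
  Cod :: "'m \<Rightarrow> 'o"
  Id :: "'o \<Rightarrow> 'm"
  Comp :: "'m \<Rightarrow> 'm \<Rightarrow> 'm"  (infixl "\<cdot>\<index>" 70)
  Le :: "'m \<Rightarrow> 'm \<Rightarrow> bool"  (infix "\<preceq>\<index>" 50)

definition hom :: "('o, 'm) ord_cat \<Rightarrow> 'o \<Rightarrow> 'o \<Rightarrow> 'm set" where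
  "hom C A B = {f \<in> Mor C. Dom C f = A \<and> Cod C f = B}"

locale ord_category =
  fixes C :: "('o, 'm) ord_cat" (structure)
  assumes Dom_Ob: "f \<in> Mor C \<Longrightarrow> Dom C f \<in> Ob C"
    and Cod_Ob: "f \<in> Mor C \<Longrightarrow> Cod C f \<in> Ob C"
    and Id_hom: "A \<in> Ob C \<Longrightarrow> Id C A \<in> hom C A A"
    and Comp_hom: "\<lbrakk>f \<in> hom C A B; g \<in> hom C B D\<rbrakk> \<Longrightarrow> g \<cdot> f \<in> hom C A D"
    and Comp_Id: "f \<in> hom C A B \<Longrightarrow> f \<cdot> Id C A = f"
    and Id_Comp: "f \<in> hom C A B \<Longrightarrow> Id C B \<cdot> f = f"
    and Comp_assoc:
      "\<lbrakk>f \<in> hom C A B; g \<in> hom C B D; h \<in> hom C D E\<rbrakk> \<Longrightarrow> (h \<cdot> g) \<cdot> f = h \<cdot> (g \<cdot> f)"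
    and Le_refl: "f \<in> hom C A B \<Longrightarrow> f \<preceq> f"
    and Le_trans:
      "\<lbrakk>f \<in> hom C A B; g \<in> hom C A B; h \<in> hom C A B; f \<preceq> g; g \<preceq> h\<rbrakk> \<Longrightarrow> f \<preceq> h"
    and Le_antisym: "\<lbrakk>f \<in> hom C A B; g \<in> hom C A B; f \<preceq> g; g \<preceq> f\<rbrakk> \<Longrightarrow> f = g"
    and Comp_mono:
      "\<lbrakk>f \<in> hom C A B; f' \<in> hom C A B; g \<in> hom C B D; g' \<in> hom C B D; f \<preceq> f'; g \<preceq> g'\<rbrakk>
        \<Longrightarrow> g \<cdot> f \<preceq> g' \<cdot> f'"


section \<open>Functors and oplax natural transformations\<close>

text \<open>A functor is given by its object map and its morphism map. It is an ordinary functor of the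
  underlying categories: monotonicity on hom-sets is not required.\<close>

definition is_functor ::
  "('o, 'm) ord_cat \<Rightarrow> ('p, 'n) ord_cat \<Rightarrow> ('o \<Rightarrow> 'p) \<Rightarrow> ('m \<Rightarrow> 'n) \<Rightarrow> bool" where
  "is_functor C D So Sa \<longleftrightarrow>
     (\<forall>A\<in>Ob C. So A \<in> Ob D) \<and>
     (\<forall>f\<in>Mor C. Sa f \<in> hom D (So (Dom C f)) (So (Cod C f))) \<and>
     (\<forall>A\<in>Ob C. Sa (Id C A) = Id D (So A)) \<and>
     (\<forall>f\<in>Mor C. \<forall>g\<in>Mor C. Cod C f = Dom C g \<longrightarrow>
        Sa (g \<cdot>\<^bsub>C\<^esub> f) = Sa g \<cdot>\<^bsub>D\<^esub> Sa f)"

definition oplax_transformation ::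
  "('o, 'm) ord_cat \<Rightarrow> ('p, 'n) ord_cat \<Rightarrow> ('o \<Rightarrow> 'p) \<Rightarrow> ('m \<Rightarrow> 'n) \<Rightarrow> ('o \<Rightarrow> 'p) \<Rightarrow> ('m \<Rightarrow> 'n)
    \<Rightarrow> ('o \<Rightarrow> 'n) \<Rightarrow> bool" where
  "oplax_transformation C D So Sa To Ta \<alpha> \<longleftrightarrow>
     (\<forall>X\<in>Ob C. \<alpha> X \<in> hom D (So X) (To X)) \<and>
     (\<forall>h\<in>Mor C. \<alpha> (Cod C h) \<cdot>\<^bsub>D\<^esub> Sa h \<preceq>\<^bsub>D\<^esub> Ta h \<cdot>\<^bsub>D\<^esub> \<alpha> (Dom C h))"


section \<open>Lax monads, lax comonads and distributivity laws\<close>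

definition lax_monad ::
  "('o, 'm) ord_cat \<Rightarrow> ('o \<Rightarrow> 'o) \<Rightarrow> ('m \<Rightarrow> 'm) \<Rightarrow> ('o \<Rightarrow> 'm) \<Rightarrow> ('o \<Rightarrow> 'm) \<Rightarrow> bool" where
  "lax_monad D To Ta \<eta> \<mu> \<longleftrightarrow>
     is_functor D D To Ta \<and>
     oplax_transformation D D id id To Ta \<eta> \<and>
     oplax_transformation D D (To \<circ> To) (Ta \<circ> Ta) To Ta \<mu> \<and>
     (\<forall>X\<in>Ob D.
        Id D (To X) \<preceq>\<^bsub>D\<^esub> \<mu> X \<cdot>\<^bsub>D\<^esub> Ta (\<eta> X) \<and>
        \<mu> X \<cdot>\<^bsub>D\<^esub> \<eta> (To X) \<preceq>\<^bsub>D\<^esub> Id D (To X) \<and>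
        \<mu> X \<cdot>\<^bsub>D\<^esub> Ta (\<mu> X) \<preceq>\<^bsub>D\<^esub> \<mu> X \<cdot>\<^bsub>D\<^esub> \<mu> (To X))"

definition lax_comonad ::
  "('o, 'm) ord_cat \<Rightarrow> ('o \<Rightarrow> 'o) \<Rightarrow> ('m \<Rightarrow> 'm) \<Rightarrow> ('o \<Rightarrow> 'm) \<Rightarrow> ('o \<Rightarrow> 'm) \<Rightarrow> bool" where
  "lax_comonad D To Ta \<epsilon> \<delta> \<longleftrightarrow>
     is_functor D D To Ta \<and>
     oplax_transformation D D To Ta id id \<epsilon> \<and>
     oplax_transformation D D To Ta (To \<circ> To) (Ta \<circ> Ta) \<delta> \<and>
     (\<forall>X\<in>Ob D.
        Ta (\<epsilon> X) \<cdot>\<^bsub>D\<^esub> \<delta> X \<preceq>\<^bsub>D\<^esub> Id D (To X) \<and>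
        Id D (To X) \<preceq>\<^bsub>D\<^esub> \<epsilon> (To X) \<cdot>\<^bsub>D\<^esub> \<delta> X \<and>
        \<delta> (To X) \<cdot>\<^bsub>D\<^esub> \<delta> X \<preceq>\<^bsub>D\<^esub> Ta (\<delta> X) \<cdot>\<^bsub>D\<^esub> \<delta> X)"

definition distributivity_law ::
  "('o, 'm) ord_cat \<Rightarrow> ('o \<Rightarrow> 'o) \<Rightarrow> ('m \<Rightarrow> 'm) \<Rightarrow> ('o \<Rightarrow> 'm) \<Rightarrow> ('o \<Rightarrow> 'o) \<Rightarrow> ('m \<Rightarrow> 'm) \<Rightarrow> ('o \<Rightarrow> 'm)
    \<Rightarrow> ('o \<Rightarrow> 'm) \<Rightarrow> bool" where
  "distributivity_law D Lo La \<delta> Ro Ra \<mu> \<Delta> \<longleftrightarrow>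
     oplax_transformation D D (Lo \<circ> Ro) (La \<circ> Ra) (Ro \<circ> Lo) (Ra \<circ> La) \<Delta> \<and>
     (\<forall>X\<in>Ob D.
        \<Delta> X \<cdot>\<^bsub>D\<^esub> La (\<mu> X) = \<mu> (Lo X) \<cdot>\<^bsub>D\<^esub> Ra (\<Delta> X) \<cdot>\<^bsub>D\<^esub> \<Delta> (Ro X) \<and>
        Ra (\<delta> X) \<cdot>\<^bsub>D\<^esub> \<Delta> X = \<Delta> (Lo X) \<cdot>\<^bsub>D\<^esub> La (\<Delta> X) \<cdot>\<^bsub>D\<^esub> \<delta> (Ro X))"


section \<open>The category of morphisms and lax squares\<close>

text \<open>\<open>Square f g u v\<close> stands for \<open>(u, v) : f \<rightarrow> g\<close>. The source and target are recorded because the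
  same pair \<open>(u, v)\<close> may be a lax square between several pairs of morphisms.\<close>

datatype 'm square = Square (sq_src: 'm) (sq_tgt: 'm) (dom_part: 'm) (cod_part: 'm)

definition lax_squares :: "('o, 'm) ord_cat \<Rightarrow> 'm square set" where
  "lax_squares C =
     {Square f g u v | f g u v. f \<in> Mor C \<and> g \<in> Mor C \<and>
        u \<in> hom C (Dom C f) (Dom C g) \<and> v \<in> hom C (Cod C f) (Cod C g) \<and>
        g \<cdot>\<^bsub>C\<^esub> u \<preceq>\<^bsub>C\<^esub> v \<cdot>\<^bsub>C\<^esub> f}"

definition lax_arrow_cat :: "('o, 'm) ord_cat \<Rightarrow> ('m, 'm square) ord_cat" where
  "lax_arrow_cat C =
     \<lparr>Ob = Mor C, Mor = lax_squares C, Dom = sq_src, Cod = sq_tgt,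
      Id = (\<lambda>f. Square f f (Id C (Dom C f)) (Id C (Cod C f))),
      Comp = (\<lambda>t s. Square (sq_src s) (sq_tgt t)
                (dom_part t \<cdot>\<^bsub>C\<^esub> dom_part s) (cod_part t \<cdot>\<^bsub>C\<^esub> cod_part s)),
      Le = (\<lambda>s t. sq_src s = sq_src t \<and> sq_tgt s = sq_tgt t \<and>
                dom_part s \<preceq>\<^bsub>C\<^esub> dom_part t \<and> cod_part s \<preceq>\<^bsub>C\<^esub> cod_part t)\<rparr>"


section \<open>Lax weak factorisation systems\<close>

definition lax_orth :: "('o, 'm) ord_cat \<Rightarrow> 'm \<Rightarrow> 'm \<Rightarrow> bool" where
  "lax_orth C f g \<longleftrightarrow>
     (\<forall>u v. Square f g u v \<in> lax_squares C \<longrightarrow>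
        (\<exists>d\<in>hom C (Cod C f) (Dom C g). u \<preceq>\<^bsub>C\<^esub> d \<cdot>\<^bsub>C\<^esub> f \<and> g \<cdot>\<^bsub>C\<^esub> d \<preceq>\<^bsub>C\<^esub> v))"

definition lax_wfs :: "('o, 'm) ord_cat \<Rightarrow> 'm set \<Rightarrow> 'm set \<Rightarrow> bool" where
  "lax_wfs C \<L> \<R> \<longleftrightarrow>
     \<R> = {g \<in> Mor C. \<forall>f\<in>\<L>. lax_orth C f g} \<and>
     \<L> = {f \<in> Mor C. \<forall>g\<in>\<R>. lax_orth C f g} \<and>
     (\<forall>h\<in>Mor C. \<exists>l\<in>\<L>. \<exists>r\<in>\<R>. Cod C l = Dom C r \<and> h = r \<cdot>\<^bsub>C\<^esub> l)"


section \<open>Lax functorial factorisation systems\<close>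

text \<open>\<open>Ko f\<close> is the object through which \<open>f\<close> factors and \<open>Ka\<close> is the action of \<open>K\<close> on lax squares.
  The functor \<open>F\<close> is not a separate parameter: it sends \<open>f\<close> to the composable pair \<open>(L f, R f)\<close> and
  \<open>(u, v)\<close> to the composable pair of squares \<open>(u, K(u, v))\<close>, \<open>(K(u, v), v)\<close>.\<close>

definition lax_functorial_factorisation ::
  "('o, 'm) ord_cat \<Rightarrow> ('m \<Rightarrow> 'm) \<Rightarrow> ('m \<Rightarrow> 'm) \<Rightarrow> ('m \<Rightarrow> 'o) \<Rightarrow> ('m square \<Rightarrow> 'm) \<Rightarrow> bool" where
  "lax_functorial_factorisation C L R Ko Ka \<longleftrightarrow>
     (\<forall>f\<in>Mor C. Ko f \<in> Ob C \<and> L f \<in> hom C (Dom C f) (Ko f) \<and> R f \<in> hom C (Ko f) (Cod C f) \<and>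
        R f \<cdot>\<^bsub>C\<^esub> L f = f) \<and>
     is_functor (lax_arrow_cat C) C Ko Ka \<and>
     (\<forall>f g u v. Square f g u v \<in> lax_squares C \<longrightarrow>
        L g \<cdot>\<^bsub>C\<^esub> u \<preceq>\<^bsub>C\<^esub> Ka (Square f g u v) \<cdot>\<^bsub>C\<^esub> L f \<and>
        R g \<cdot>\<^bsub>C\<^esub> Ka (Square f g u v) \<preceq>\<^bsub>C\<^esub> v \<cdot>\<^bsub>C\<^esub> R f)"

definition L_arr :: "('m \<Rightarrow> 'm) \<Rightarrow> ('m square \<Rightarrow> 'm) \<Rightarrow> 'm square \<Rightarrow> 'm square" where
  "L_arr L Ka s = Square (L (sq_src s)) (L (sq_tgt s)) (dom_part s) (Ka s)"

definition R_arr :: "('m \<Rightarrow> 'm) \<Rightarrow> ('m square \<Rightarrow> 'm) \<Rightarrow> 'm square \<Rightarrow> 'm square" where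
  "R_arr R Ka s = Square (R (sq_src s)) (R (sq_tgt s)) (Ka s) (cod_part s)"

definition fact_unit ::
  "('o, 'm) ord_cat \<Rightarrow> ('m \<Rightarrow> 'm) \<Rightarrow> ('m \<Rightarrow> 'm) \<Rightarrow> 'm \<Rightarrow> 'm square" where
  "fact_unit C L R f = Square f (R f) (L f) (Id C (Cod C f))"

definition fact_counit ::
  "('o, 'm) ord_cat \<Rightarrow> ('m \<Rightarrow> 'm) \<Rightarrow> ('m \<Rightarrow> 'm) \<Rightarrow> 'm \<Rightarrow> 'm square" where
  "fact_counit C L R f = Square (L f) f (Id C (Dom C f)) (R f)"


section \<open>Lax algebraic weak factorisation systems\<close>

text \<open>The (co)unit inequalities and antisymmetry force \<open>\<Omega> f = (id, \<omega> f) : L f \<rightarrow> L (L f)\<close> and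
  \<open>\<Theta> f = (\<theta> f, id) : R (R f) \<rightarrow> R f\<close>, with \<open>\<omega> f : K f \<rightarrow> K (L f)\<close> and \<open>\<theta> f : K (R f) \<rightarrow> K f\<close>.
  As for ordinary algebraic weak factorisation systems, the distributivity law is the canonical
  \<open>\<Delta> f = (\<omega> f, \<theta> f) : L (R f) \<rightarrow> R (L f)\<close>. In particular \<open>(\<omega> f, \<theta> f)\<close> is a lax square, that is,
  \<open>R (L f) \<cdot> \<omega> f \<preceq> \<theta> f \<cdot> L (R f)\<close>. With a law \<open>\<Delta>\<close> unrelated to \<open>\<Omega>\<close> and \<open>\<Theta>\<close> the notion would
  be too weak: \<open>L f\<close> need not be lax orthogonal to \<open>R g\<close>.\<close>

definition lax_awfs ::
  "('o, 'm) ord_cat \<Rightarrow> ('m \<Rightarrow> 'm) \<Rightarrow> ('m \<Rightarrow> 'm) \<Rightarrow> ('m \<Rightarrow> 'o) \<Rightarrow> ('m square \<Rightarrow> 'm) \<Rightarrow> bool" where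
  "lax_awfs C L R Ko Ka \<longleftrightarrow>
     lax_functorial_factorisation C L R Ko Ka \<and>
     (\<exists>\<Theta> \<Omega> \<Delta>.
        lax_monad (lax_arrow_cat C) R (R_arr R Ka) (fact_unit C L R) \<Theta> \<and>
        lax_comonad (lax_arrow_cat C) L (L_arr L Ka) (fact_counit C L R) \<Omega> \<and>
        distributivity_law (lax_arrow_cat C) L (L_arr L Ka) \<Omega> R (R_arr R Ka) \<Theta> \<Delta> \<and>
        (\<forall>f\<in>Mor C. \<Delta> f = Square (L (R f)) (R (L f)) (cod_part (\<Omega> f)) (dom_part (\<Theta> f))))"

end

theory Submission
  imports Defs
begin

text \<open>The unit laws and antisymmetry force \<open>\<Omega> f = (id, \<omega> f)\<close> and \<open>\<Theta> f = (\<theta> f, id)\<close>, with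
  \<open>id \<preceq> R (L f) \<cdot> \<omega> f\<close> and \<open>\<theta> f \<cdot> L (R f) \<preceq> id\<close>. These inequalities point the wrong
  way for the lifting property, but the lax square \<open>\<Delta> f = (\<omega> f, \<theta> f)\<close> links them into
  \<open>id \<preceq> R (L f) \<cdot> \<omega> f \<preceq> \<theta> f \<cdot> L (R f) \<preceq> id\<close>, so both are equalities. Then
  \<open>d = \<theta> g \<cdot> K (u, v) \<cdot> \<omega> f\<close> is a lax diagonal for every lax square \<open>(u, v) : L f \<rightarrow> R g\<close>. The
  lax weak factorisation system is the Galois closure of the class of all \<open>L f\<close>.\<close>

text \<open>Lax orthogonality is a Galois connection between classes of morphisms. The double
  orthogonal of \<open>J\<close> contains \<open>J\<close>, so being orthogonal to it is the same as
  being orthogonal to \<open>J\<close>. Factorisations whose left factor lies in \<open>J\<close>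
  itself therefore suffice.\<close>

lemma lax_wfs_generated:
  assumes "J \<subseteq> Mor C"
    and "\<And>h. h \<in> Mor C \<Longrightarrow>
      \<exists>l\<in>J. \<exists>r\<in>Mor C. Cod C l = Dom C r \<and> h = r \<cdot>\<^bsub>C\<^esub> l \<and> (\<forall>j\<in>J. lax_orth C j r)"
  defines "\<R> \<equiv> {g \<in> Mor C. \<forall>j\<in>J. lax_orth C j g}"
  shows "lax_wfs C {f \<in> Mor C. \<forall>g\<in>\<R>. lax_orth C f g} \<R>"
  using assms(1,2) unfolding lax_wfs_def \<R>_def by blast

lemma Square_in_lax_squares_iff:
  "Square f g u v \<in> lax_squares C \<longleftrightarrow>
     f \<in> Mor C \<and> g \<in> Mor C \<and> u \<in> hom C (Dom C f) (Dom C g) \<and> v \<in> hom C (Cod C f) (Cod C g) \<and>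
     g \<cdot>\<^bsub>C\<^esub> u \<preceq>\<^bsub>C\<^esub> v \<cdot>\<^bsub>C\<^esub> f"
  by (auto simp: lax_squares_def)

lemma lax_arrow_cat_simps [simp]:
  "Ob (lax_arrow_cat C) = Mor C"
  "Mor (lax_arrow_cat C) = lax_squares C"
  "Dom (lax_arrow_cat C) = sq_src"
  "Cod (lax_arrow_cat C) = sq_tgt"
  "Id (lax_arrow_cat C) f = Square f f (Id C (Dom C f)) (Id C (Cod C f))"
  "t \<cdot>\<^bsub>lax_arrow_cat C\<^esub> s = Square (sq_src s) (sq_tgt t)
     (dom_part t \<cdot>\<^bsub>C\<^esub> dom_part s) (cod_part t \<cdot>\<^bsub>C\<^esub> cod_part s)"
  "s \<preceq>\<^bsub>lax_arrow_cat C\<^esub> t \<longleftrightarrow> sq_src s = sq_src t \<and> sq_tgt s = sq_tgt t \<and>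
     dom_part s \<preceq>\<^bsub>C\<^esub> dom_part t \<and> cod_part s \<preceq>\<^bsub>C\<^esub> cod_part t"
  by (simp_all add: lax_arrow_cat_def)

lemma in_hom_lax_arrow_cat_iff:
  "s \<in> hom (lax_arrow_cat C) f g \<longleftrightarrow>
     s = Square f g (dom_part s) (cod_part s) \<and> s \<in> lax_squares C"
  by (cases s) (auto simp: hom_def)

context ord_category
begin

lemma Comp_left_mono:
  assumes "f \<in> hom C A B" "f' \<in> hom C A B" "g \<in> hom C B D" "f \<preceq> f'"
  shows "g \<cdot> f \<preceq> g \<cdot> f'"
  using assms by (meson Comp_mono Le_refl)

lemma Comp_right_mono:
  assumes "f \<in> hom C A B" "g \<in> hom C B D" "g' \<in> hom C B D" "g \<preceq> g'"
  shows "g \<cdot> f \<preceq> g' \<cdot> f"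
  using assms by (meson Comp_mono Le_refl)

text \<open>Translates the data at a single \<open>f\<close> from lax squares into morphisms of
  \<open>C\<close>. This lets the lifting argument take \<open>\<omega>\<close> at one morphism and
  \<open>\<theta>\<close> at another.\<close>

lemma lax_awfs_components:
  assumes awfs: "lax_awfs C L R Ko Ka" and f: "f \<in> Mor C"
  obtains \<theta> \<omega> where
    "\<omega> \<in> hom C (Ko f) (Ko (L f))"
    "\<theta> \<in> hom C (Ko (R f)) (Ko f)"
    "L (L f) \<preceq> \<omega> \<cdot> L f"
    "R f \<cdot> \<theta> \<preceq> R (R f)"
    "R (L f) \<cdot> \<omega> = Id C (Ko f)"
    "\<theta> \<cdot> L (R f) = Id C (Ko f)"
proof -
  let ?D = "lax_arrow_cat C"
  from awfs obtain \<Theta> \<Omega> \<Delta> where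
    fact: "lax_functorial_factorisation C L R Ko Ka" and
    monad: "lax_monad ?D R (R_arr R Ka) (fact_unit C L R) \<Theta>" and
    comonad: "lax_comonad ?D L (L_arr L Ka) (fact_counit C L R) \<Omega>" and
    law: "distributivity_law ?D L (L_arr L Ka) \<Omega> R (R_arr R Ka) \<Theta> \<Delta>" and
    \<Delta>: "\<forall>f\<in>Mor C. \<Delta> f = Square (L (R f)) (R (L f)) (cod_part (\<Omega> f)) (dom_part (\<Theta> f))"
    unfolding lax_awfs_def by blast
  have LR: "L h \<in> hom C (Dom C h) (Ko h)" "R h \<in> hom C (Ko h) (Cod C h)" "Ko h \<in> Ob C"
    if "h \<in> Mor C" for h
    using fact that by (auto simp: lax_functorial_factorisation_def)
  have LRf: "L f \<in> Mor C" "R f \<in> Mor C" "Dom C (L f) = Dom C f" "Cod C (L f) = Ko f"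
    "Dom C (R f) = Ko f" "Cod C (R f) = Cod C f"
    using LR[OF f] by (auto simp: hom_def)
  note LLf = LR[OF LRf(1), unfolded LRf] and RRf = LR[OF LRf(2), unfolded LRf]
  have LLf': "L (L f) \<in> Mor C" "R (L f) \<in> Mor C" "Dom C (L (L f)) = Dom C f"
    "Cod C (L (L f)) = Ko (L f)" "Dom C (R (L f)) = Ko (L f)" "Cod C (R (L f)) = Ko f"
    and RRf': "L (R f) \<in> Mor C" "R (R f) \<in> Mor C" "Dom C (L (R f)) = Ko f"
    "Cod C (L (R f)) = Ko (R f)" "Dom C (R (R f)) = Ko (R f)" "Cod C (R (R f)) = Cod C f"
    using LLf RRf by (auto simp: hom_def)
  note facts = LRf LLf' RRf'
  have "\<Omega> f \<in> hom ?D (L f) (L (L f))"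
    using comonad f unfolding lax_comonad_def oplax_transformation_def lax_arrow_cat_simps(1) comp_apply
    by blast
  then obtain a \<omega> where \<Omega>: "\<Omega> f = Square (L f) (L (L f)) a \<omega>"
    and \<Omega>_sq: "Square (L f) (L (L f)) a \<omega> \<in> lax_squares C"
    unfolding in_hom_lax_arrow_cat_iff by metis
  have "\<Theta> f \<in> hom ?D (R (R f)) (R f)"
    using monad f unfolding lax_monad_def oplax_transformation_def lax_arrow_cat_simps(1) comp_apply
    by blast
  then obtain \<theta> b where \<Theta>: "\<Theta> f = Square (R (R f)) (R f) \<theta> b"
    and \<Theta>_sq: "Square (R (R f)) (R f) \<theta> b \<in> lax_squares C"
    unfolding in_hom_lax_arrow_cat_iff by metis
  have "\<Delta> f \<in> hom ?D (L (R f)) (R (L f))"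
    using law f unfolding distributivity_law_def oplax_transformation_def lax_arrow_cat_simps(1)
      comp_apply by blast
  then have "\<Delta> f \<in> lax_squares C"
    by (simp add: hom_def)
  \<comment> \<open>By the canonical form of \<open>\<Delta> f\<close>, this is exactly its
    condition for being a lax square.\<close>
  then have \<Delta>_le: "R (L f) \<cdot> \<omega> \<preceq> \<theta> \<cdot> L (R f)"
    by (simp add: bspec[OF \<Delta> f] \<Omega> \<Theta> Square_in_lax_squares_iff)
  have a: "a \<in> hom C (Dom C f) (Dom C f)" and \<omega>: "\<omega> \<in> hom C (Ko f) (Ko (L f))"
    and \<omega>_le: "L (L f) \<cdot> a \<preceq> \<omega> \<cdot> L f"
    using \<Omega>_sq by (simp_all add: Square_in_lax_squares_iff facts)
  have b: "b \<in> hom C (Cod C f) (Cod C f)" and \<theta>: "\<theta> \<in> hom C (Ko (R f)) (Ko f)"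
    and \<theta>_le: "R f \<cdot> \<theta> \<preceq> b \<cdot> R (R f)"
    using \<Theta>_sq by (simp_all add: Square_in_lax_squares_iff facts)
  note ids = Id_hom[OF Dom_Ob[OF f]] Id_hom[OF Cod_Ob[OF f]] Id_hom[OF LR(3)[OF f]]
  \<comment> \<open>Squares are ordered componentwise: the domain parts of the two counit laws bound
    \<open>a\<close> from both sides, and the codomain part of the second bounds
    \<open>R (L f) \<cdot> \<omega>\<close> from below.\<close>
  have "L_arr L Ka (fact_counit C L R f) \<cdot>\<^bsub>?D\<^esub> \<Omega> f \<preceq>\<^bsub>?D\<^esub> Id ?D (L f)"
    "Id ?D (L f) \<preceq>\<^bsub>?D\<^esub> fact_counit C L R (L f) \<cdot>\<^bsub>?D\<^esub> \<Omega> f"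
    using comonad f unfolding lax_comonad_def lax_arrow_cat_simps(1) by blast+
  then have "Id C (Dom C f) \<cdot> a \<preceq> Id C (Dom C f)" "Id C (Dom C f) \<preceq> Id C (Dom C f) \<cdot> a"
    and \<omega>_unit: "Id C (Ko f) \<preceq> R (L f) \<cdot> \<omega>"
    by (simp_all add: L_arr_def fact_counit_def \<Omega> facts)
  then have a_id: "a = Id C (Dom C f)"
    using Le_antisym[OF a ids(1)] by (simp add: Id_Comp[OF a])
  \<comment> \<open>Dually, the codomain parts of the unit laws pin down \<open>b\<close>, and the
    domain part of the second bounds \<open>\<theta> \<cdot> L (R f)\<close> from above.\<close>
  have "Id ?D (R f) \<preceq>\<^bsub>?D\<^esub> \<Theta> f \<cdot>\<^bsub>?D\<^esub> R_arr R Ka (fact_unit C L R f)"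
    "\<Theta> f \<cdot>\<^bsub>?D\<^esub> fact_unit C L R (R f) \<preceq>\<^bsub>?D\<^esub> Id ?D (R f)"
    using monad f unfolding lax_monad_def lax_arrow_cat_simps(1) by blast+
  then have "Id C (Cod C f) \<preceq> b \<cdot> Id C (Cod C f)" "b \<cdot> Id C (Cod C f) \<preceq> Id C (Cod C f)"
    and \<theta>_unit: "\<theta> \<cdot> L (R f) \<preceq> Id C (Ko f)"
    by (simp_all add: R_arr_def fact_unit_def \<Theta> facts)
  then have b_id: "b = Id C (Cod C f)"
    using Le_antisym[OF b ids(2)] by (simp add: Comp_Id[OF b])
  have R\<omega>: "R (L f) \<cdot> \<omega> \<in> hom C (Ko f) (Ko f)"
    using Comp_hom[OF \<omega> LLf(2)] .
  have \<theta>L: "\<theta> \<cdot> L (R f) \<in> hom C (Ko f) (Ko f)"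
    using Comp_hom[OF RRf(1) \<theta>] .
  have "R (L f) \<cdot> \<omega> = Id C (Ko f)" "\<theta> \<cdot> L (R f) = Id C (Ko f)"
    using Le_antisym[OF R\<omega> ids(3) Le_trans[OF R\<omega> \<theta>L ids(3) \<Delta>_le \<theta>_unit] \<omega>_unit]
      Le_antisym[OF \<theta>L ids(3) \<theta>_unit Le_trans[OF ids(3) R\<omega> \<theta>L \<omega>_unit \<Delta>_le]] .
  moreover have "L (L f) \<preceq> \<omega> \<cdot> L f"
    using \<omega>_le by (simp add: a_id Comp_Id[OF LLf(1)])
  moreover have "R f \<cdot> \<theta> \<preceq> R (R f)"
    using \<theta>_le by (simp add: b_id Id_Comp[OF RRf(2)])
  ultimately show thesis
    using \<omega> \<theta> that by blast
qed

text \<open>This is the lifting of a coalgebra against an algebra: \<open>\<omega>\<close> at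
  \<open>f\<close> is the structure on \<open>L f\<close>, \<open>\<theta>\<close> at
  \<open>g\<close> the structure on \<open>R g\<close>, and \<open>K\<close> of the given square
  joins them.\<close>

lemma lax_awfs_orth:
  assumes awfs: "lax_awfs C L R Ko Ka" and f: "f \<in> Mor C" and g: "g \<in> Mor C"
  shows "lax_orth C (L f) (R g)"
  unfolding lax_orth_def
proof (intro allI impI)
  fix u v
  assume sq: "Square (L f) (R g) u v \<in> lax_squares C"
  obtain \<omega> where \<omega>: "\<omega> \<in> hom C (Ko f) (Ko (L f))" and \<omega>_le: "L (L f) \<preceq> \<omega> \<cdot> L f"
    and R\<omega>: "R (L f) \<cdot> \<omega> = Id C (Ko f)"
    using lax_awfs_components[OF awfs f] by blast
  obtain \<theta> where \<theta>: "\<theta> \<in> hom C (Ko (R g)) (Ko g)" and \<theta>_le: "R g \<cdot> \<theta> \<preceq> R (R g)"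
    and \<theta>L: "\<theta> \<cdot> L (R g) = Id C (Ko g)"
    using lax_awfs_components[OF awfs g] by blast
  have fact: "lax_functorial_factorisation C L R Ko Ka"
    using awfs by (simp add: lax_awfs_def)
  have LR: "L h \<in> hom C (Dom C h) (Ko h)" "R h \<in> hom C (Ko h) (Cod C h)" if "h \<in> Mor C" for h
    using fact that by (auto simp: lax_functorial_factorisation_def)
  note Lf = LR(1)[OF f] and Rg = LR(2)[OF g]
  have ends: "Dom C (L f) = Dom C f" "Cod C (L f) = Ko f" "Dom C (R g) = Ko g"
    "Cod C (R g) = Cod C g" and mor: "L f \<in> Mor C" "R g \<in> Mor C"
    using Lf Rg by (auto simp: hom_def)
  note LLf = LR[OF mor(1), unfolded ends] and RRg = LR[OF mor(2), unfolded ends]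
  have u: "u \<in> hom C (Dom C f) (Ko g)" and v: "v \<in> hom C (Ko f) (Cod C g)"
    using sq by (auto simp: Square_in_lax_squares_iff ends)
  \<comment> \<open>\<open>K\<close> is applied to the square from \<open>L f\<close> to
    \<open>R g\<close>, so \<open>k\<close> runs from the codomain of \<open>\<omega>\<close> to the
    domain of \<open>\<theta>\<close>.\<close>
  define k where "k = Ka (Square (L f) (R g) u v)"
  have k: "k \<in> hom C (Ko (L f)) (Ko (R g))"
    using fact sq by (auto simp: lax_functorial_factorisation_def is_functor_def k_def)
  have k_le: "L (R g) \<cdot> u \<preceq> k \<cdot> L (L f)" "R (R g) \<cdot> k \<preceq> v \<cdot> R (L f)"
    using fact sq by (auto simp: lax_functorial_factorisation_def k_def)
  note k\<omega> = Comp_hom[OF \<omega> k]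
  note d = Comp_hom[OF k\<omega> \<theta>]
  note \<theta>k = Comp_hom[OF k \<theta>]
  \<comment> \<open>Upper triangle: insert \<open>\<theta> \<cdot> L (R g)\<close>, pass
    \<open>u\<close> across the left square of \<open>k\<close>, then replace \<open>L (L f)\<close>
    by \<open>\<omega> \<cdot> L f\<close>. The insertion uses
    \<open>id \<preceq> \<theta> \<cdot> L (R g)\<close>, the direction that the monad law does not
    give.\<close>
  have "u = \<theta> \<cdot> (L (R g) \<cdot> u)"
    using Comp_assoc[OF u RRg(1) \<theta>] by (simp add: \<theta>L Id_Comp[OF u])
  moreover have "\<theta> \<cdot> (L (R g) \<cdot> u) \<preceq> \<theta> \<cdot> (k \<cdot> L (L f))"
    by (rule Comp_left_mono[OF Comp_hom[OF u RRg(1)] Comp_hom[OF LLf(1) k] \<theta> k_le(1)])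
  moreover have "\<theta> \<cdot> (k \<cdot> L (L f)) = (\<theta> \<cdot> k) \<cdot> L (L f)"
    by (simp add: Comp_assoc[OF LLf(1) k \<theta>])
  moreover have "(\<theta> \<cdot> k) \<cdot> L (L f) \<preceq> (\<theta> \<cdot> k) \<cdot> (\<omega> \<cdot> L f)"
    by (rule Comp_left_mono[OF LLf(1) Comp_hom[OF Lf \<omega>] \<theta>k \<omega>_le])
  moreover have "(\<theta> \<cdot> k) \<cdot> (\<omega> \<cdot> L f) = (\<theta> \<cdot> (k \<cdot> \<omega>)) \<cdot> L f"
    by (simp add: Comp_assoc[OF \<omega> k \<theta>] flip: Comp_assoc[OF Lf \<omega> \<theta>k])
  ultimately have upper: "u \<preceq> (\<theta> \<cdot> (k \<cdot> \<omega>)) \<cdot> L f"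
    using Le_trans[OF u Comp_hom[OF LLf(1) \<theta>k] Comp_hom[OF Lf d]] by simp
  \<comment> \<open>Lower triangle, dually: absorb \<open>\<theta>\<close> into
    \<open>R (R g)\<close>, cross the right square of \<open>k\<close>, then cancel
    \<open>R (L f) \<cdot> \<omega>\<close>. The cancellation uses the direction that the comonad
    law does not give.\<close>
  have "R g \<cdot> (\<theta> \<cdot> (k \<cdot> \<omega>)) = (R g \<cdot> \<theta>) \<cdot> (k \<cdot> \<omega>)"
    by (simp add: Comp_assoc[OF k\<omega> \<theta> Rg])
  moreover have "(R g \<cdot> \<theta>) \<cdot> (k \<cdot> \<omega>) \<preceq> R (R g) \<cdot> (k \<cdot> \<omega>)"
    by (rule Comp_right_mono[OF k\<omega> Comp_hom[OF \<theta> Rg] RRg(2) \<theta>_le])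
  moreover have "R (R g) \<cdot> (k \<cdot> \<omega>) = (R (R g) \<cdot> k) \<cdot> \<omega>"
    by (simp add: Comp_assoc[OF \<omega> k RRg(2)])
  moreover have "(R (R g) \<cdot> k) \<cdot> \<omega> \<preceq> (v \<cdot> R (L f)) \<cdot> \<omega>"
    by (rule Comp_right_mono[OF \<omega> Comp_hom[OF k RRg(2)] Comp_hom[OF LLf(2) v] k_le(2)])
  moreover have "(v \<cdot> R (L f)) \<cdot> \<omega> = v"
    by (simp add: Comp_assoc[OF \<omega> LLf(2) v] R\<omega> Comp_Id[OF v])
  ultimately have lower: "R g \<cdot> (\<theta> \<cdot> (k \<cdot> \<omega>)) \<preceq> v"
    using Le_trans[OF Comp_hom[OF d Rg] Comp_hom[OF k\<omega> RRg(2)] v] by simp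
  show "\<exists>d\<in>hom C (Cod C (L f)) (Dom C (R g)). u \<preceq> d \<cdot> L f \<and> R g \<cdot> d \<preceq> v"
    using d upper lower by (auto simp: ends)
qed

end

theorem proposition4p3:
  fixes C :: "('o, 'm) ord_cat"
    and L R :: "'m \<Rightarrow> 'm"
    and Ko :: "'m \<Rightarrow> 'o"
    and Ka :: "'m square \<Rightarrow> 'm"
  assumes "ord_category C"
    and "lax_awfs C L R Ko Ka"
  shows "\<exists>\<L> \<R>. lax_wfs C \<L> \<R> \<and> (\<forall>f\<in>Mor C. L f \<in> \<L> \<and> R f \<in> \<R>)"
proof -
  interpret ord_category C by (rule assms(1))
  let ?J = "L ` Mor C"
  \<comment> \<open>Orthogonality of every \<open>L f\<close> to every \<open>R g\<close> is what
    puts each \<open>R g\<close> into this class. Each \<open>L f\<close> lies in the double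
    orthogonal because it is a generator.\<close>
  let ?R = "{g \<in> Mor C. \<forall>j\<in>?J. lax_orth C j g}"
  have orth: "lax_orth C (L f) (R g)" if "f \<in> Mor C" "g \<in> Mor C" for f g
    using lax_awfs_orth[OF assms(2) that] .
  have fact: "L f \<in> Mor C" "R f \<in> Mor C" "Cod C (L f) = Dom C (R f)" "R f \<cdot>\<^bsub>C\<^esub> L f = f"
    if "f \<in> Mor C" for f
    using assms(2) that by (auto simp: lax_awfs_def lax_functorial_factorisation_def hom_def)
  have "lax_wfs C {f \<in> Mor C. \<forall>g\<in>?R. lax_orth C f g} ?R"
  proof (rule lax_wfs_generated)
    show "?J \<subseteq> Mor C"
      using fact by blast
    show "\<exists>l\<in>?J. \<exists>r\<in>Mor C. Cod C l = Dom C r \<and> h = r \<cdot>\<^bsub>C\<^esub> l \<and> (\<forall>j\<in>?J. lax_orth C j r)"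
      if "h \<in> Mor C" for h
      \<comment> \<open>The witnesses are \<open>L h\<close> and \<open>R h\<close>.\<close>
      using fact[OF that] orth that by force
  qed
  moreover have "L f \<in> {f \<in> Mor C. \<forall>g\<in>?R. lax_orth C f g} \<and> R f \<in> ?R" if "f \<in> Mor C" for f
    using fact[OF that] orth that by blast
  ultimately show ?thesis
    by blast
qed

end
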